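(* Let $p$ be a prime number, let $d\ge 1$ be an integer, and let $A\subset\mathbb Z^d$ be a set with $|A|=p$. If $A$ tiles $\mathbb Z^d$, then $A$ is also spectral in $\mathbb Z^d$.
   Context: Let $G$ be a finitely generated Abelian group and $A\subseteq G$. The set $A$ is tiling in $G$ (or $A$ tiles $G$, or $A$ is a tile) if there exists $B\subseteq G$ such that the translates $\{A+b\}_{b\in B}$ form a partition of $G$. The set $A$ is spectral in $G$ if there exists a set $S$ of group characters of $G$ (homomorphisms from $G$ to the unit circle in $\mathbb C$; for $G=\mathbb Z^d$ these are continuous characters of the discrete group) whose restrictions to $A$ form an orthogonal basis of $L^2(A)$, where $A$ carries the counting measure; distinct elements of $S$ give distinct basis elements, so $|S|=|A|$ for finite $A$. *)

theory Defs
  imports "HOL-Analysis.Analysis" "HOL-Computational_Algebra.Primes"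
begin

definition tiles :: "'a::ab_group_add set \<Rightarrow> bool" where
  "tiles A \<longleftrightarrow>
     (\<exists>B. disjoint_family_on (\<lambda>b. (\<lambda>a. a + b) ` A) B \<and> (\<Union>b\<in>B. (\<lambda>a. a + b) ` A) = UNIV)"

(* The group is regarded as discrete, so continuity of a character is automatic. *)
definition group_character :: "('a::ab_group_add \<Rightarrow> complex) \<Rightarrow> bool" where
  "group_character \<phi> \<longleftrightarrow> (\<forall>x. \<phi> x \<in> sphere 0 1) \<and> (\<forall>x y. \<phi> (x + y) = \<phi> x * \<phi> y)"

(* Functions on A are represented by elements of extensional A, so that two of them
   are equal iff they agree on A. No further identification is needed, since the empty
   set is the only null set of the counting measure. *)
definition L2_on :: "'a set \<Rightarrow> ('a \<Rightarrow> complex) set" where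
  "L2_on A = {f \<in> extensional A. integrable (count_space A) (\<lambda>x. (cmod (f x))\<^sup>2)}"

definition L2_inner :: "'a set \<Rightarrow> ('a \<Rightarrow> complex) \<Rightarrow> ('a \<Rightarrow> complex) \<Rightarrow> complex" where
  "L2_inner A f g = (LINT x|count_space A. f x * cnj (g x))"

definition L2_dist :: "'a set \<Rightarrow> ('a \<Rightarrow> complex) \<Rightarrow> ('a \<Rightarrow> complex) \<Rightarrow> real" where
  "L2_dist A f g = sqrt (LINT x|count_space A. (cmod (f x - g x))\<^sup>2)"

(* Orthogonal basis in the Hilbert space sense: nonzero, pairwise orthogonal vectors
   whose finite linear combinations are dense. For finite A density of the span is
   the same as spanning. *)
definition orthogonal_basis_L2 :: "'a set \<Rightarrow> ('a \<Rightarrow> complex) set \<Rightarrow> bool" where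
  "orthogonal_basis_L2 A F \<longleftrightarrow>
     F \<subseteq> L2_on A \<and>
     (\<forall>f\<in>F. L2_inner A f f \<noteq> 0) \<and>
     (\<forall>f\<in>F. \<forall>g\<in>F. f \<noteq> g \<longrightarrow> L2_inner A f g = 0) \<and>
     (\<forall>h\<in>L2_on A. \<forall>e>0. \<exists>T c. finite T \<and> T \<subseteq> F \<and>
        L2_dist A h (\<lambda>x. \<Sum>f\<in>T. c f * f x) < e)"

definition spectral :: "'a::ab_group_add set \<Rightarrow> bool" where
  "spectral A \<longleftrightarrow>
     (\<exists>S. (\<forall>\<phi>\<in>S. group_character \<phi>) \<and>
          inj_on (\<lambda>\<phi>. restrict \<phi> A) S \<and>
          orthogonal_basis_L2 A ((\<lambda>\<phi>. restrict \<phi> A) ` S))"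

end

theory Submission
  imports Defs "HOL-Number_Theory.Residues"
begin

text \<open>
  Let \<open>p = card A\<close> and let \<open>f\<close> be the indicator function of a translation set of the tiling, so that
  \<open>\<Sum>a\<in>A. f (x - a) = 1\<close>. For a prime \<open>q\<close>, the Frobenius congruence in the group ring gives
  \<open>\<Sum>a\<in>A. f (x - q a) \<equiv> p\<^sup>q\<^sup>-\<^sup>1\<close> modulo \<open>q\<close>. For \<open>q = p\<close> this forces \<open>f\<close> to be invariant under
  \<open>p (a - b)\<close> for all \<open>a, b \<in> A\<close>; for \<open>q \<noteq> p\<close> it forces the dilate \<open>q A\<close> to tile with the same translation
  set, and hence so does \<open>t A\<close> for every \<open>t\<close> prime to \<open>p\<close>. A nonzero difference \<open>f (x + d) - f x\<close> is annihilated by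
  all these dilates and can be projected to a joint eigenfunction of the translations by \<open>a - a0\<close>.
  Its eigenvalues are \<open>p\<close>-th roots of unity \<open>w\<^sub>a\<close> with \<open>\<Sum>a\<in>A. w\<^sub>a\<^sup>t = 0\<close> for \<open>0 < t < p\<close>, so they are
  pairwise distinct. They extend to a character of the whole group, whose powers form a spectrum.
\<close>

subsection \<open>Iterated convolution and the Frobenius congruence\<close>

text \<open>For finite \<open>A\<close>, this is the \<open>n\<close>-th power of the group ring
  element with coefficient 1 on \<open>A\<close>, acting on \<open>f\<close> by convolution.\<close>

primrec conv_pow :: "(int ^ 'd) set \<Rightarrow> nat \<Rightarrow> (int ^ 'd \<Rightarrow> int) \<Rightarrow> int ^ 'd \<Rightarrow> int" where
  "conv_pow A 0 f x = f x"
| "conv_pow A (Suc n) f x = (\<Sum>a\<in>A. conv_pow A n f (x - a))"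

text \<open>The binomial theorem in the commutative group ring: \<open>k\<close> of the
  \<open>n\<close> factors act through \<open>A\<close>, the other \<open>n - k\<close> translate by
  \<open>b\<close>.\<close>

lemma conv_pow_insert:
  assumes "finite A" "b \<notin> A"
  shows "conv_pow (insert b A) n f x =
    (\<Sum>k\<le>n. of_nat (n choose k) * conv_pow A k f (x - int (n - k) *s b))"
proof (induction n arbitrary: x)
  case (Suc n)
  let ?P = "\<lambda>k y. conv_pow A k f y"
  have shift: "x - b - int (n - k) *s b = x - int (Suc n - k) *s b" if "k \<le> n" for k
    using that by (simp add: Suc_diff_le algebra_simps)
  have first: "conv_pow (insert b A) n f (x - b) =
      (\<Sum>k\<le>n. of_nat (n choose k) * ?P k (x - int (Suc n - k) *s b))"
    unfolding Suc.IH by (intro sum.cong refl) (simp only: shift atMost_iff)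
  have "(\<Sum>a\<in>A. conv_pow (insert b A) n f (x - a)) =
      (\<Sum>k\<le>n. \<Sum>a\<in>A. of_nat (n choose k) * ?P k (x - a - int (n - k) *s b))"
    unfolding Suc.IH by (rule sum.swap)
  also have "\<dots> = (\<Sum>k\<le>n. of_nat (n choose k) * ?P (Suc k) (x - int (n - k) *s b))"
    by (simp add: sum_distrib_left algebra_simps)
  finally have second: "(\<Sum>a\<in>A. conv_pow (insert b A) n f (x - a)) =
      (\<Sum>k\<le>n. of_nat (n choose k) * ?P (Suc k) (x - int (n - k) *s b))" .
  let ?Q = "\<lambda>k. ?P k (x - int (Suc n - k) *s b)"
  \<comment> \<open>Pascal's rule separates the sums in \<open>first\<close> and
    \<open>second\<close>; the top term \<open>k = Suc n\<close> left over in the former vanishes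
    with \<open>n choose Suc n\<close>.\<close>
  have "(\<Sum>k\<le>Suc n. of_nat (Suc n choose k) * ?Q k) =
      ?Q 0 + (\<Sum>k\<le>n. of_nat (Suc n choose Suc k) * ?Q (Suc k))"
    by (subst sum.atMost_Suc_shift) simp
  also have "\<dots> = (?Q 0 + (\<Sum>k\<le>n. of_nat (n choose Suc k) * ?Q (Suc k)))
      + (\<Sum>k\<le>n. of_nat (n choose k) * ?Q (Suc k))"
    by (simp add: sum.distrib algebra_simps)
  also have "?Q 0 + (\<Sum>k\<le>n. of_nat (n choose Suc k) * ?Q (Suc k)) =
      (\<Sum>k\<le>Suc n. of_nat (n choose k) * ?Q k)"
    by (subst sum.atMost_Suc_shift) simp
  also have "\<dots> = (\<Sum>k\<le>n. of_nat (n choose k) * ?Q k)"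
    by simp
  finally show ?case
    using first second assms by simp
qed simp

text \<open>The Frobenius map in characteristic \<open>q\<close>: when \<open>A\<close> grows by one
  element, all binomial terms except the two outer ones are divisible by \<open>q\<close>.\<close>

lemma conv_pow_prime_cong:
  assumes "finite A" "prime q"
  shows "[conv_pow A q f x = (\<Sum>a\<in>A. f (x - int q *s a))] (mod int q)"
  using assms(1)
proof (induction A)
  case empty
  \<comment> \<open>A positive exponent matters: \<open>conv_pow {} 0 f\<close> is \<open>f\<close>,
    while the empty sum is 0.\<close>
  obtain m where "q = Suc m"
    using prime_gt_0_nat[OF assms(2)] gr0_implies_Suc by blast
  then show ?case by simp
next
  case (insert b A)
  have q: "q > 0" using prime_gt_0_nat[OF assms(2)] .
  let ?t = "\<lambda>k. of_nat (q choose k) * conv_pow A k f (x - int (q - k) *s b)"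
  have "{..q} = insert 0 (insert q {0<..<q})" using q by auto
  then have "conv_pow (insert b A) q f x = ?t 0 + (?t q + (\<Sum>k\<in>{0<..<q}. ?t k))"
    unfolding conv_pow_insert[OF insert.hyps] using q by simp
  moreover have "int q dvd (\<Sum>k\<in>{0<..<q}. ?t k)"
  proof (rule dvd_sum)
    fix k assume "k \<in> {0<..<q}"
    then have "q dvd q choose k"
      using assms(2) by (intro dvd_choose_prime) auto
    then show "int q dvd ?t k" by simp
  qed
  moreover have "?t 0 = f (x - int q *s b)" "?t q = conv_pow A q f x"
    by simp_all
  ultimately have "[conv_pow (insert b A) q f x = f (x - int q *s b) + conv_pow A q f x] (mod int q)"
    by (simp add: cong_iff_dvd_diff)
  also have "[f (x - int q *s b) + conv_pow A q f x =
      f (x - int q *s b) + (\<Sum>a\<in>A. f (x - int q *s a))] (mod int q)"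
    using insert.IH by (rule cong_add[OF cong_refl])
  finally show ?case using insert.hyps by simp
qed

lemma conv_pow_const:
  fixes f :: "int ^ 'd \<Rightarrow> int"
  assumes "\<And>x. (\<Sum>a\<in>A. f (x - a)) = 1"
  shows "conv_pow A (Suc n) f x = int (card A) ^ n"
  by (induction n arbitrary: x) (simp_all add: assms)

text \<open>The first of the \<open>q\<close> convolutions turns \<open>f\<close> into the constant
  1, and each of the other \<open>q - 1\<close> multiplies by \<open>card A\<close>.\<close>

lemma dilated_sum_cong:
  fixes f :: "int ^ 'd \<Rightarrow> int"
  assumes "finite A" "prime q" "\<And>x. (\<Sum>a\<in>A. f (x - a)) = 1"
  shows "[(\<Sum>a\<in>A. f (x - int q *s a)) = int (card A) ^ (q - 1)] (mod int q)"
proof -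
  have "conv_pow A q f x = int (card A) ^ (q - 1)"
    using conv_pow_const[OF assms(3), of "q - 1" x] prime_gt_0_nat[OF assms(2)] by simp
  then show ?thesis
    using conv_pow_prime_cong[OF assms(1,2), of f x] by (simp add: cong_sym_eq)
qed

subsection \<open>Dilates of a tile\<close>

text \<open>By Fermat's little theorem the dilated sum is 1 modulo \<open>q\<close>; being
  nonnegative, it is at least 1. Averaging then excludes larger values.\<close>

lemma prime_dilate_sum:
  fixes f :: "int ^ 'd \<Rightarrow> int"
  assumes fin: "finite A" and q: "prime q" "\<not> q dvd card A"
    and one: "\<And>x. (\<Sum>a\<in>A. f (x - a)) = 1" and nonneg: "\<And>x. f x \<ge> 0"
  shows "(\<Sum>a\<in>A. f (x - int q *s a)) = 1"
proof -
  define h where "h x = (\<Sum>a\<in>A. f (x - int q *s a))" for x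
  have pos: "h x \<ge> 1" for x
  proof -
    have "[h x = int (card A) ^ (q - 1)] (mod int q)"
      unfolding h_def by (rule dilated_sum_cong[OF fin q(1) one])
    also have "[int (card A) ^ (q - 1) = 1] (mod int q)"
      using fermat_theorem[OF q] by (metis cong_int_iff of_nat_1 of_nat_power)
    finally have "h x \<noteq> 0"
      using prime_gt_1_nat[OF q(1)] by (auto simp: cong_def)
    moreover have "h x \<ge> 0" unfolding h_def by (simp add: nonneg sum_nonneg)
    ultimately show ?thesis by linarith
  qed
  \<comment> \<open>Summing \<open>h\<close> over \<open>y - A\<close> gives \<open>card A\<close>, so the lower bound 1 is attained everywhere.\<close>
  have "A \<noteq> {}" using one[of 0] by auto
  then obtain a0 where a0: "a0 \<in> A" by blast
  have "(\<Sum>a\<in>A. h (y - a)) = int (card A)" for y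
  proof -
    have "(\<Sum>a\<in>A. h (y - a)) = (\<Sum>b\<in>A. \<Sum>a\<in>A. f (y - int q *s b - a))"
      unfolding h_def by (subst sum.swap) (simp add: algebra_simps)
    then show ?thesis by (simp add: one)
  qed
  \<comment> \<open>The centre \<open>x + a0\<close> makes \<open>h x - 1\<close> one of these
    nonnegative summands.\<close>
  then have "(\<Sum>a\<in>A. h (x + a0 - a) - 1) = 0"
    by (simp add: sum_subtractf)
  then have "\<forall>a\<in>A. h (x + a0 - a) - 1 = 0"
    by (subst (asm) sum_nonneg_eq_0_iff[OF fin]) (use pos in \<open>simp_all add: int_one_le_iff_zero_less\<close>)
  with a0 show ?thesis unfolding h_def by fastforce
qed

text \<open>Prime factors of \<open>t\<close> are peeled off one at a time. The dilate by the
  cofactor \<open>s\<close> satisfies the hypotheses of the prime case, with the same cardinality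
  because scaling by \<open>s > 0\<close> is injective.\<close>

lemma coprime_dilate_sum:
  fixes f :: "int ^ 'd \<Rightarrow> int"
  assumes "finite A" "t > 0" "coprime t (card A)"
    and "\<And>x. (\<Sum>a\<in>A. f (x - a)) = 1" "\<And>x. f x \<ge> 0"
  shows "(\<Sum>a\<in>A. f (x - int t *s a)) = 1"
  using assms(2,3)
proof (induction t arbitrary: x rule: less_induct)
  case (less t)
  show ?case
  proof (cases "t = 1")
    case False
    then obtain q where q: "prime q" "q dvd t" using prime_factor_nat by blast
    then obtain s where s: "t = q * s" by blast
    have sp: "s > 0" "s < t" "coprime s (card A)"
      using less.prems q(1) s prime_gt_1_nat[OF q(1)] by auto
    have ndvd: "\<not> q dvd card A"
      using less.prems(2) q by (meson coprime_common_divisor_nat not_prime_unit coprime_common_divisor)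
    define A' where "A' = (\<lambda>a. int s *s a) ` A"
    have inj: "inj_on (\<lambda>a. int s *s a) A"
      using sp(1) by (auto intro!: inj_onI simp: vec_eq_iff)
    have "(\<Sum>a\<in>A'. f (x - int q *s a)) = 1"
    proof (rule prime_dilate_sum)
      show "\<not> q dvd card A'" using ndvd by (simp add: A'_def card_image[OF inj])
      show "(\<Sum>a\<in>A'. f (y - a)) = 1" for y
        using less.IH[OF sp(2,1,3)] by (simp add: A'_def sum.reindex[OF inj])
    qed (use assms q in \<open>auto simp: A'_def\<close>)
    then show ?thesis by (simp add: A'_def sum.reindex[OF inj] s)
  qed (simp add: assms)
qed

text \<open>For \<open>q = p\<close> the dilated sum is divisible by \<open>p\<close> and has
  \<open>p\<close> terms in {0, 1}, so these are all 0 or all 1: \<open>f (y - p c)\<close> does not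
  depend on \<open>c \<in> A\<close>.\<close>

lemma prime_tile_periodic:
  assumes p: "prime (card A)"
    and one: "\<And>x. (\<Sum>a\<in>A. f (x - a)) = 1" and range: "\<And>x. f x \<in> {0, 1::int}"
    and ab: "a \<in> A" "b \<in> A"
  shows "f (x + int (card A) *s (a - b)) = f x"
proof -
  let ?p = "card A"
  have fin: "finite A" by (rule card_ge_0_finite[OF prime_gt_0_nat[OF p]])
  have dich: "(\<forall>c\<in>A. f (y - int ?p *s c) = 0) \<or> (\<forall>c\<in>A. f (y - int ?p *s c) = 1)" for y
  proof -
    let ?s = "\<Sum>c\<in>A. f (y - int ?p *s c)"
    have "[?s = int ?p ^ (?p - 1)] (mod int ?p)"
      by (rule dilated_sum_cong[OF fin p one])
    moreover have "int ?p dvd int ?p ^ (?p - 1)"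
      using prime_gt_1_nat[OF p] by simp
    ultimately have dvd: "int ?p dvd ?s" by (simp add: cong_dvd_iff)
    have r: "0 \<le> f z" "f z \<le> 1" for z using range[of z] by auto
    have s: "0 \<le> ?s" "?s \<le> int ?p"
      using sum_nonneg[of A "\<lambda>c. f (y - int ?p *s c)"] sum_mono[of A "\<lambda>c. f (y - int ?p *s c)" "\<lambda>_. 1"]
      by (simp_all add: r)
    show ?thesis
    proof (cases "?s = 0")
      case True
      then show ?thesis using sum_nonneg_eq_0_iff[OF fin, of "\<lambda>c. f (y - int ?p *s c)"] r by simp
    next
      case False
      then have "?s = int ?p" using zdvd_imp_le[OF dvd] s by linarith
      then have "(\<Sum>c\<in>A. 1 - f (y - int ?p *s c)) = 0" by (simp add: sum_subtractf)
      then show ?thesis using sum_nonneg_eq_0_iff[OF fin, of "\<lambda>c. 1 - f (y - int ?p *s c)"] r by simp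
    qed
  qed
  \<comment> \<open>Both points have the form \<open>y - int ?p *s c\<close> with \<open>c\<close>
    in \<open>A\<close>, for the same \<open>y = x + int ?p *s a\<close>.\<close>
  have "x + int ?p *s (a - b) = (x + int ?p *s a) - int ?p *s b"
    by simp
  moreover have "x = (x + int ?p *s a) - int ?p *s a" by simp
  ultimately show ?thesis using dich[of "x + int ?p *s a"] ab by metis
qed

subsection \<open>Joint eigenfunctions of translations\<close>

lemma root_of_unity_sum:
  fixes z :: complex
  assumes "z ^ p = 1"
  shows "(\<Sum>n<p. z ^ n) = (if z = 1 then of_nat p else 0)"
  using assms geometric_sum[of z p] by auto

lemma exists_primitive_root:
  assumes "p > 0"
  obtains w :: complex where "w ^ p = 1" "\<And>n. 0 < n \<Longrightarrow> n < p \<Longrightarrow> w ^ n \<noteq> 1"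
proof
  let ?w = "exp (2 * of_real pi * \<i> * of_nat 1 / of_nat p) :: complex"
  show "?w ^ p = 1" using complex_root_unity[of p 1] assms by simp
  show "?w ^ n \<noteq> 1" if "0 < n" "n < p" for n
  proof -
    have "?w ^ n = exp (2 * of_real pi * \<i> * of_nat n / of_nat p)"
      by (simp add: exp_of_nat_mult[symmetric] algebra_simps)
    then show ?thesis using that assms complex_root_unity_eq_1[of p n] by (auto dest: dvd_imp_le)
  qed
qed

text \<open>Up to a factor \<open>p\<close>, the projection of a function with period \<open>p d\<close> onto the eigenspace with
  eigenvalue \<open>1 / z\<close> of the translation by \<open>d\<close>, for a \<open>p\<close>-th root of unity \<open>z\<close>.\<close>
definition twisted_sum :: "nat \<Rightarrow> int ^ 'd \<Rightarrow> complex \<Rightarrow> (int ^ 'd \<Rightarrow> complex) \<Rightarrow> int ^ 'd \<Rightarrow> complex" where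
  "twisted_sum p d z g x = (\<Sum>n<p. z ^ n * g (x + int n *s d))"

lemma shift_Suc: "x + d + int n *s d = x + int (Suc n) *s d"
  by (simp add: add.assoc)

text \<open>Translating by \<open>d\<close> shifts the index by one; the new term
  \<open>n = p\<close> agrees with the lost term \<open>n = 0\<close> because
  \<open>z ^ p = 1\<close> and \<open>g\<close> has period \<open>p d\<close>.\<close>

lemma twisted_sum_eigen:
  assumes "z ^ p = 1" "p > 0" "\<And>x. g (x + int p *s d) = g x"
  shows "z * twisted_sum p d z g (x + d) = twisted_sum p d z g x"
proof -
  let ?u = "\<lambda>n. z ^ n * g (x + int n *s d)"
  have "z * twisted_sum p d z g (x + d) = (\<Sum>n<p. ?u (Suc n))"
    unfolding twisted_sum_def sum_distrib_left shift_Suc by (simp add: mult.assoc)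
  also have "\<dots> = (\<Sum>n<Suc p. ?u n) - ?u 0" by (subst sum.lessThan_Suc_shift) simp
  also have "\<dots> = (\<Sum>n<p. ?u n)" using assms by simp
  finally show ?thesis by (simp add: twisted_sum_def)
qed

text \<open>Fourier inversion on the cyclic group of order \<open>p\<close>: the twisted sums over
  all \<open>p\<close>-th roots of unity add up to \<open>p\<close> times \<open>g x\<close>, so one
  of them is nonzero.\<close>

lemma twisted_sum_nonzero:
  assumes "p > 0" "g x \<noteq> 0"
  obtains z where "z ^ p = 1" "twisted_sum p d z g x \<noteq> 0"
proof -
  obtain w :: complex where w: "w ^ p = 1" "\<And>n. 0 < n \<Longrightarrow> n < p \<Longrightarrow> w ^ n \<noteq> 1"
    using exists_primitive_root[OF assms(1)] by blast
  have "(\<Sum>j<p. twisted_sum p d (w ^ j) g x) =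
      (\<Sum>n<p. (\<Sum>j<p. (w ^ n) ^ j) * g (x + int n *s d))"
    unfolding twisted_sum_def sum_distrib_right power_mult[symmetric]
    by (subst sum.swap) (simp only: mult.commute[of "_ :: nat"])
  also have "\<dots> = (\<Sum>n<p. if n = 0 then of_nat p * g x else 0)"
  proof (intro sum.cong refl)
    fix n assume "n \<in> {..<p}"
    moreover have "(w ^ n) ^ p = 1" using w(1) by (metis power_mult power_one mult.commute)
    ultimately show "(\<Sum>j<p. (w ^ n) ^ j) * g (x + int n *s d) = (if n = 0 then of_nat p * g x else 0)"
      using w(2)[of n] root_of_unity_sum[of "w ^ n" p] by auto
  qed
  also have "\<dots> = of_nat p * g x" using assms(1) by simp
  finally have "(\<Sum>j<p. twisted_sum p d (w ^ j) g x) \<noteq> 0" using assms by simp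
  then obtain j where "twisted_sum p d (w ^ j) g x \<noteq> 0" using sum.not_neutral_contains_not_neutral by blast
  moreover have "(w ^ j) ^ p = 1" using w(1) by (metis power_mult power_one mult.commute)
  ultimately show ?thesis using that by blast
qed

text \<open>Translations commute, so projecting for one \<open>d\<close> after another keeps the
  eigenvalues already obtained. \<open>Q\<close> stands for any further property that the
  projections preserve.\<close>

lemma joint_eigenfunction:
  fixes D :: "(int ^ 'd) set"
  assumes "finite D" "p > 0"
    and "\<And>d x. d \<in> D \<Longrightarrow> G (x + int p *s d) = G x" "G x0 \<noteq> 0"
    and "Q G" and "\<And>g d z. Q g \<Longrightarrow> Q (twisted_sum p d z g)"
  obtains g w x1 where "Q g" "g x1 \<noteq> 0" "\<And>d. d \<in> D \<Longrightarrow> w d ^ p = 1"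
    "\<And>d x. d \<in> D \<Longrightarrow> g (x + d) = w d * g x"
proof -
  \<comment> \<open>Periodicity is carried for all of \<open>D\<close>, not only for the processed
    part \<open>E\<close>, since the later projections rely on it.\<close>
  have "\<exists>g w x1. Q g \<and> g x1 \<noteq> 0 \<and> (\<forall>d\<in>D. \<forall>x. g (x + int p *s d) = g x) \<and>
      (\<forall>d\<in>E. w d ^ p = 1) \<and> (\<forall>d\<in>E. \<forall>x. g (x + d) = w d * g x)" if "finite E" "E \<subseteq> D" for E
    using that
  proof (induction E)
    case empty
    show ?case using assms by auto
  next
    case (insert e E)
    then obtain g w x1 where g: "Q g" "g x1 \<noteq> 0" "\<And>d x. d \<in> D \<Longrightarrow> g (x + int p *s d) = g x"
      "\<And>d. d \<in> E \<Longrightarrow> w d ^ p = 1" "\<And>d x. d \<in> E \<Longrightarrow> g (x + d) = w d * g x"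
      by (metis insert_subset)
    obtain z where z: "z ^ p = 1" "twisted_sum p e z g x1 \<noteq> 0"
      using twisted_sum_nonzero[where g = g, OF assms(2) g(2)] by blast
    have z0: "z \<noteq> 0" using z(1) assms(2) by (metis power_0_left less_irrefl zero_neq_one)
    let ?h = "twisted_sum p e z g"
    have right_commute: "x + u + v = x + v + u" for x u v :: "int ^ 'd"
      by (simp add: add.commute add.left_commute)
    have "?h (x + int p *s d) = ?h x" if "d \<in> D" for d x
      unfolding twisted_sum_def right_commute[of x "int p *s d"] g(3)[OF that] ..
    moreover have "?h (x + d) = w d * ?h x" if "d \<in> E" for d x
      unfolding twisted_sum_def right_commute[of x d] g(5)[OF that]
      by (simp add: sum_distrib_left mult.left_commute)
    moreover have "?h (x + e) = inverse z * ?h x" for x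
      using twisted_sum_eigen[OF z(1) assms(2), of g e x] g(3)[of e] insert.prems z0 by (simp add: field_simps)
    ultimately show ?case
      using assms(6)[OF g(1)] z g(4) insert.hyps
      by (intro exI[of _ ?h] exI[of _ "w(e := inverse z)"] exI[of _ x1])
         (auto simp: power_inverse)
  qed
  from this[OF assms(1) order_refl] show ?thesis using that by blast
qed

subsection \<open>Extension of characters\<close>

text \<open>A subgroup bundled with a unitary character on it. Values of \<open>\<theta>\<close> off
  \<open>H\<close> are unconstrained, so extending means agreeing on \<open>H\<close>.\<close>

definition char_on :: "(int ^ 'd) set \<Rightarrow> (int ^ 'd \<Rightarrow> complex) \<Rightarrow> bool" where
  "char_on H \<theta> \<longleftrightarrow> 0 \<in> H \<and> (\<forall>x\<in>H. - x \<in> H) \<and> (\<forall>x\<in>H. norm (\<theta> x) = 1) \<and>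
    (\<forall>x\<in>H. \<forall>y\<in>H. x + y \<in> H \<and> \<theta> (x + y) = \<theta> x * \<theta> y)"

lemma char_on_closed:
  assumes "char_on H \<theta>"
  shows "0 \<in> H" "x \<in> H \<Longrightarrow> - x \<in> H" "x \<in> H \<Longrightarrow> y \<in> H \<Longrightarrow> x + y \<in> H"
    "x \<in> H \<Longrightarrow> y \<in> H \<Longrightarrow> x - y \<in> H"
  using assms unfolding char_on_def by (blast, blast, blast, metis diff_conv_add_uminus)

lemma char_on_norm: "char_on H \<theta> \<Longrightarrow> x \<in> H \<Longrightarrow> norm (\<theta> x) = 1"
  unfolding char_on_def by blast

lemma char_on_add: "char_on H \<theta> \<Longrightarrow> x \<in> H \<Longrightarrow> y \<in> H \<Longrightarrow> \<theta> (x + y) = \<theta> x * \<theta> y"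
  unfolding char_on_def by blast

lemma char_on_zero:
  assumes "char_on H \<theta>"
  shows "\<theta> 0 = 1"
proof -
  have "\<theta> 0 = \<theta> 0 * \<theta> 0"
    using char_on_add[OF assms, of 0 0] char_on_closed(1)[OF assms] by simp
  moreover have "\<theta> 0 \<noteq> 0"
    using char_on_norm[OF assms char_on_closed(1)[OF assms]] by auto
  ultimately show ?thesis by simp
qed

lemma char_on_uminus:
  assumes "char_on H \<theta>" "x \<in> H"
  shows "\<theta> (- x) = inverse (\<theta> x)"
  using char_on_add[OF assms char_on_closed(2)[OF assms]] char_on_zero[OF assms(1)]
  by (simp add: inverse_unique)

lemma char_on_nat_mult:
  assumes "char_on H \<theta>" "x \<in> H"
  shows "int n *s x \<in> H \<and> \<theta> (int n *s x) = \<theta> x ^ n"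
proof (induction n)
  case (Suc n)
  have "int (Suc n) *s x = x + int n *s x" by simp
  then show ?case using Suc char_on_add[OF assms] char_on_closed(3)[OF assms] by simp
qed (simp add: char_on_closed(1)[OF assms(1)] char_on_zero[OF assms(1)])

lemma char_on_int_mult:
  assumes "char_on H \<theta>" "x \<in> H"
  shows "n *s x \<in> H" "\<theta> (n *s x) = \<theta> x powi n"
proof -
  have "n *s x \<in> H \<and> \<theta> (n *s x) = \<theta> x powi n"
  proof (cases "n \<ge> 0")
    case True
    then show ?thesis using char_on_nat_mult[OF assms, of "nat n"] by (simp add: power_int_def)
  next
    case False
    then have "n *s x = - (int (nat (- n)) *s x)" by (simp add: vector_smult_lneg)
    then show ?thesis
      using char_on_nat_mult[OF assms, of "nat (- n)"] False
      by (simp add: power_int_def char_on_closed(2)[OF assms(1)] char_on_uminus[OF assms(1)] power_inverse)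
  qed
  then show "n *s x \<in> H" "\<theta> (n *s x) = \<theta> x powi n" by blast+
qed

text \<open>Supplies a value \<open>z\<close> for a new generator \<open>e\<close> that is
  consistent with \<open>\<theta>\<close> on the multiples of \<open>e\<close> in \<open>H\<close>.
  It exists because the circle group is divisible.\<close>

lemma char_on_compatible_root:
  assumes \<theta>: "char_on H \<theta>"
  obtains z where "norm z = 1" "\<And>n. n *s e \<in> H \<Longrightarrow> \<theta> (n *s e) = z powi n"
proof (cases "\<exists>n>0. int n *s e \<in> H")
  case False
  have "n = 0" if "n *s e \<in> H" for n
  proof (rule ccontr)
    assume "n \<noteq> 0"
    have "int (nat \<bar>n\<bar>) *s e \<in> H"
      using that char_on_closed(2)[OF \<theta> that] by (auto simp: abs_if vector_smult_lneg)
    then show False using False \<open>n \<noteq> 0\<close> by (metis zero_less_abs_iff zero_less_nat_eq)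
  qed
  then have "\<theta> (n *s e) = 1 powi n" if "n *s e \<in> H" for n
    using that char_on_zero[OF \<theta>] by fastforce
  then show ?thesis using that[of 1] by simp
next
  case True
  \<comment> \<open>\<open>m\<close> generates the group of integers \<open>n\<close> with
    \<open>n *s e \<in> H\<close>: by minimality the remainder of such an \<open>n\<close> modulo
    \<open>m\<close> is 0. So an \<open>m\<close>-th root of \<open>\<theta> (int m *s e)\<close> is
    what is needed.\<close>
  define m where "m = (LEAST n. n > 0 \<and> int n *s e \<in> H)"
  have m: "m > 0" "int m *s e \<in> H"
    using LeastI_ex[OF True] unfolding m_def by auto
  obtain z where z: "\<theta> (int m *s e) = z ^ m"
    using exists_complex_root[of m "\<theta> (int m *s e)"] m(1) by (metis less_irrefl)
  have "norm z ^ m = 1"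
    using char_on_norm[OF \<theta> m(2)] z by (metis norm_power)
  then have nz: "norm z = 1" using m(1) power_eq_1_iff[of "norm z" m] by simp
  have "\<theta> (n *s e) = z powi n" if n: "n *s e \<in> H" for n
  proof -
    define q r where "q = n div int m" and "r = nat (n mod int m)"
    have n_eq: "n = q * int m + int r" "r < m" using m(1) by (auto simp: q_def r_def nat_less_iff)
    have "int r *s e = n *s e - q *s (int m *s e)"
      by (simp add: n_eq)
    then have "int r *s e \<in> H"
      using char_on_closed(4)[OF \<theta> n] char_on_int_mult(1)[OF \<theta> m(2)] by presburger
    then have "r = 0" using not_less_Least[of r "\<lambda>n. n > 0 \<and> int n *s e \<in> H"] n_eq(2) m_def by auto
    then have "n *s e = q *s (int m *s e)" by (simp add: n_eq)
    then have "\<theta> (n *s e) = (z ^ m) powi q" using char_on_int_mult(2)[OF \<theta> m(2)] z by simp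
    also have "\<dots> = z powi n"
      using \<open>r = 0\<close> by (simp add: n_eq mult.commute[of q] power_int_mult)
    finally show ?thesis .
  qed
  then show ?thesis using that nz by blast
qed

lemma char_on_extend_one:
  assumes \<theta>: "char_on H \<theta>"
  obtains H' \<theta>' where "char_on H' \<theta>'" "H \<subseteq> H'" "e \<in> H'" "\<And>x. x \<in> H \<Longrightarrow> \<theta>' x = \<theta> x"
proof -
  obtain z where z: "norm z = 1" "\<And>n. n *s e \<in> H \<Longrightarrow> \<theta> (n *s e) = z powi n"
    using char_on_compatible_root[OF \<theta>] by blast
  have z0: "z \<noteq> 0" using z(1) by auto
  define H' where "H' = {h + n *s e | h n. h \<in> H}"
  define \<theta>' where "\<theta>' x = (SOME w. \<exists>h\<in>H. \<exists>n. x = h + n *s e \<and> w = \<theta> h * z powi n)" for x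
  \<comment> \<open>Well-definedness: two representations of one element differ by a multiple of
    \<open>e\<close> lying in \<open>H\<close>, where \<open>z\<close> is compatible with
    \<open>\<theta>\<close>.\<close>
  have val: "\<theta>' (h + n *s e) = \<theta> h * z powi n" if h: "h \<in> H" for h n
    unfolding \<theta>'_def
  proof (rule some_equality)
    fix w assume "\<exists>h'\<in>H. \<exists>n'. h + n *s e = h' + n' *s e \<and> w = \<theta> h' * z powi n'"
    then obtain h' n' where h': "h' \<in> H" "h + n *s e = h' + n' *s e" "w = \<theta> h' * z powi n'"
      by blast
    have diff: "(n - n') *s e = h' - h" using h'(2) by (simp add: algebra_simps)
    then have mem: "(n - n') *s e \<in> H" using char_on_closed(4)[OF \<theta> h'(1) h] by simp
    have "h' = h + (n - n') *s e" using diff by simp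
    then have "\<theta> h' = \<theta> h * z powi (n - n')" using char_on_add[OF \<theta> h mem] z(2)[OF mem] by simp
    then show "w = \<theta> h * z powi n" using z0 by (simp add: h'(3) power_int_diff)
  qed (use h in blast)
  have "char_on H' \<theta>'"
    unfolding char_on_def
  proof (intro conjI ballI)
    show "0 \<in> H'" unfolding H'_def using char_on_closed(1)[OF \<theta>] by (force intro: exI[of _ 0])
  next
    fix x assume "x \<in> H'"
    then obtain h n where x: "x = h + n *s e" "h \<in> H" unfolding H'_def by blast
    have "- x = - h + (- n) *s e" by (simp add: x(1) vector_smult_lneg)
    then show "- x \<in> H'" unfolding H'_def using char_on_closed(2)[OF \<theta> x(2)] by blast
    show "norm (\<theta>' x) = 1"
      using char_on_norm[OF \<theta> x(2)] z(1) by (simp add: x val norm_mult norm_power_int)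
    fix y assume "y \<in> H'"
    then obtain k m where y: "y = k + m *s e" "k \<in> H" unfolding H'_def by blast
    have xy: "x + y = (h + k) + (n + m) *s e" by (simp add: x(1) y(1) vector_sadd_rdistrib)
    have hk: "h + k \<in> H" using char_on_closed(3)[OF \<theta> x(2) y(2)] .
    then show "x + y \<in> H'" unfolding H'_def xy by blast
    show "\<theta>' (x + y) = \<theta>' x * \<theta>' y"
      using char_on_add[OF \<theta> x(2) y(2)] z0
      by (simp only: xy val[OF hk]) (simp add: x y val power_int_add)
  qed
  moreover have "H \<subseteq> H'" unfolding H'_def by (force intro: exI[of _ 0])
  moreover have "0 + 1 *s e \<in> H'" unfolding H'_def using char_on_closed(1)[OF \<theta>] by blast
  then have "e \<in> H'" by simp
  moreover have "\<theta>' x = \<theta> x" if "x \<in> H" for x using val[OF that, of 0] by simp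
  ultimately show ?thesis using that by blast
qed

lemma char_on_sum:
  assumes "char_on H \<theta>" "\<And>i. i \<in> I \<Longrightarrow> h i \<in> H"
  shows "(\<Sum>i\<in>I. h i) \<in> H"
  using assms(2) by (induction I rule: infinite_finite_induct) (auto intro: char_on_closed[OF assms(1)])

text \<open>The standard basis vectors generate the whole group, so finitely many one-element
  extensions suffice.\<close>

lemma char_on_extend:
  fixes H :: "(int ^ 'd) set"
  assumes \<theta>: "char_on H \<theta>"
  obtains \<phi> where "group_character \<phi>" "\<And>x. x \<in> H \<Longrightarrow> \<phi> x = \<theta> x"
proof -
  have "\<exists>H' \<theta>'. char_on H' \<theta>' \<and> H \<subseteq> H' \<and> E \<subseteq> H' \<and> (\<forall>x\<in>H. \<theta>' x = \<theta> x)"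
    if "finite E" for E :: "(int ^ 'd) set"
    using that
  proof induction
    case (insert e E)
    then obtain H' \<theta>' where 1: "char_on H' \<theta>'" "H \<subseteq> H'" "E \<subseteq> H'" "\<forall>x\<in>H. \<theta>' x = \<theta> x" by blast
    obtain H'' \<theta>'' where "char_on H'' \<theta>''" "H' \<subseteq> H''" "e \<in> H''" "\<And>x. x \<in> H' \<Longrightarrow> \<theta>'' x = \<theta>' x"
      using char_on_extend_one[OF 1(1), of e] by blast
    with 1 show ?case by (intro exI[of _ H''] exI[of _ \<theta>'']) auto
  qed (use \<theta> in blast)
  from this[of "range (\<lambda>i. axis i 1)"] obtain H' \<phi>
    where \<phi>: "char_on H' \<phi>" "range (\<lambda>i. axis i 1) \<subseteq> H'" "\<forall>x\<in>H. \<phi> x = \<theta> x" by auto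
  have "x \<in> H'" for x
  proof -
    have "(\<Sum>i\<in>UNIV. (x $ i) *s axis i 1) \<in> H'"
      using \<phi>(2) by (intro char_on_sum[OF \<phi>(1)] char_on_int_mult(1)[OF \<phi>(1)]) auto
    then show ?thesis by (simp only: basis_expansion)
  qed
  then have "group_character \<phi>"
    using \<phi>(1) by (simp add: group_character_def char_on_def)
  then show ?thesis using that \<phi>(3) by blast
qed

subsection \<open>Spectra consisting of powers of one character\<close>

lemma group_character_norm: "group_character \<phi> \<Longrightarrow> norm (\<phi> x) = 1"
  by (simp add: group_character_def)

lemma group_character_power: "group_character \<phi> \<Longrightarrow> group_character (\<lambda>x. \<phi> x ^ t)"
  by (simp add: group_character_def norm_power power_mult_distrib)

text \<open>The matrix with entries \<open>\<theta> a ^ t\<close> is square; \<open>orth\<close> and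
  \<open>compl\<close> are its two orthogonality relations. The first gives an orthogonal family,
  the second an exact expansion of every function on \<open>A\<close>.\<close>

lemma spectral_of_power_characters:
  fixes A :: "'a::ab_group_add set"
  assumes fin: "finite A" and \<theta>: "group_character \<theta>"
    and orth: "\<And>s t. s < card A \<Longrightarrow> t < card A \<Longrightarrow> s \<noteq> t \<Longrightarrow> (\<Sum>a\<in>A. \<theta> a ^ s * cnj (\<theta> a) ^ t) = 0"
    and compl: "\<And>a b. a \<in> A \<Longrightarrow> b \<in> A \<Longrightarrow>
      (\<Sum>t<card A. \<theta> a ^ t * cnj (\<theta> b) ^ t) = (if a = b then of_nat (card A) else 0)"
  shows "spectral A"
proof -
  let ?p = "card A"
  define F where "F t = restrict (\<lambda>x. \<theta> x ^ t) A" for t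
  have inner: "L2_inner A h (F t) = (\<Sum>a\<in>A. h a * cnj (\<theta> a) ^ t)" for h t
    unfolding L2_inner_def F_def lebesgue_integral_count_space_finite[OF fin] by simp
  have inner_FF: "L2_inner A (F s) (F t) = (if s = t then of_nat ?p else 0)"
    if "s < ?p" "t < ?p" for s t
  proof (cases "s = t")
    case True
    have "\<theta> a * cnj (\<theta> a) = 1" for a
      using group_character_norm[OF \<theta>, of a] by (simp add: complex_norm_square[symmetric])
    then show ?thesis
      unfolding inner using True by (simp add: F_def power_mult_distrib[symmetric])
  next
    case False
    then show ?thesis using orth[OF that] unfolding inner by (simp add: F_def)
  qed
  \<comment> \<open>Orthogonality gives distinctness: if \<open>F s = F t\<close> with
    \<open>s \<noteq> t\<close>, the squared norm \<open>p\<close> would be 0.\<close>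
  have injF: "inj_on F {..<?p}"
  proof (rule inj_onI, rule ccontr)
    fix s t assume st: "s \<in> {..<?p}" "t \<in> {..<?p}" "F s = F t" "s \<noteq> t"
    then have "of_nat ?p = (0::complex)" using inner_FF[of s t] inner_FF[of t t] by simp
    then show False using st(1) by simp
  qed
  define S where "S = (\<lambda>t x. \<theta> x ^ t) ` {..<?p}"
  have img: "(\<lambda>\<phi>. restrict \<phi> A) ` S = F ` {..<?p}"
    unfolding S_def F_def by (simp add: image_image)
  have "inj_on (\<lambda>\<phi>. restrict \<phi> A) S"
  proof (rule inj_onI)
    fix \<phi> \<psi> assume "\<phi> \<in> S" "\<psi> \<in> S" "restrict \<phi> A = restrict \<psi> A"
    then obtain s t where "s < ?p" "t < ?p" "\<phi> = (\<lambda>x. \<theta> x ^ s)" "\<psi> = (\<lambda>x. \<theta> x ^ t)" "F s = F t"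
      unfolding S_def F_def by auto
    then show "\<phi> = \<psi>" using inj_onD[OF injF, of s t] by simp
  qed
  moreover have "orthogonal_basis_L2 A (F ` {..<?p})"
    unfolding orthogonal_basis_L2_def
  proof (intro conjI ballI allI impI)
    show "F ` {..<?p} \<subseteq> L2_on A"
      unfolding L2_on_def F_def using fin by (auto intro: integrable_count_space)
    show "L2_inner A f f \<noteq> 0" if "f \<in> F ` {..<?p}" for f
      using that inner_FF by fastforce
    show "L2_inner A f g = 0" if "f \<in> F ` {..<?p}" "g \<in> F ` {..<?p}" "f \<noteq> g" for f g
      using that inner_FF by fastforce
    fix h :: "'a \<Rightarrow> complex" and e :: real
    assume "e > 0"
    \<comment> \<open>Fourier coefficients: every basis vector has squared norm
      \<open>p\<close>.\<close>
    define c where "c f = L2_inner A h f / of_nat ?p" for f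
    have expand: "(\<Sum>f\<in>F ` {..<?p}. c f * f x) = h x" if x: "x \<in> A" for x
    proof -
      have "(\<Sum>f\<in>F ` {..<?p}. c f * f x) = (\<Sum>t<?p. c (F t) * \<theta> x ^ t)"
        using x by (simp add: sum.reindex[OF injF]) (simp add: F_def)
      also have "\<dots> = (\<Sum>t<?p. \<Sum>a\<in>A. h a / of_nat ?p * (\<theta> x ^ t * cnj (\<theta> a) ^ t))"
        unfolding c_def inner sum_divide_distrib sum_distrib_right
        by (intro sum.cong refl) (simp add: mult_ac)
      also have "\<dots> = (\<Sum>a\<in>A. h a / of_nat ?p * (\<Sum>t<?p. \<theta> x ^ t * cnj (\<theta> a) ^ t))"
        by (subst sum.swap) (simp add: sum_distrib_left)
      also have "\<dots> = (\<Sum>a\<in>A. if a = x then h x else 0)"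
        using x fin by (intro sum.cong refl) (auto simp: compl card_gt_0_iff)
      also have "\<dots> = h x" using x fin by simp
      finally show ?thesis .
    qed
    have "L2_dist A h (\<lambda>x. \<Sum>f\<in>F ` {..<?p}. c f * f x) = 0"
      unfolding L2_dist_def lebesgue_integral_count_space_finite[OF fin] by (simp add: expand)
    then show "\<exists>T c. finite T \<and> T \<subseteq> F ` {..<?p} \<and> L2_dist A h (\<lambda>x. \<Sum>f\<in>T. c f * f x) < e"
      using \<open>e > 0\<close> by (intro exI[of _ "F ` {..<?p}"] exI[of _ c]) auto
  qed
  moreover have "\<forall>\<phi>\<in>S. group_character \<phi>"
    unfolding S_def using group_character_power[OF \<theta>] by blast
  ultimately show ?thesis unfolding spectral_def using img by (intro exI[of _ S]) simp
qed

text \<open>All translations having \<open>g\<close> as an eigenfunction with unimodular eigenvalue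
  form a subgroup, and the eigenvalue, read off at \<open>y\<close>, is multiplicative. This avoids
  describing the subgroup generated by the given translations.\<close>

lemma eigenvalues_char_on:
  fixes g :: "int ^ 'd \<Rightarrow> complex"
  assumes "g y \<noteq> 0"
  shows "char_on {k. \<exists>l. norm l = 1 \<and> (\<forall>x. g (x + k) = l * g x)} (\<lambda>k. g (y + k) / g y)"
    (is "char_on ?H ?\<theta>")
proof -
  have val: "\<And>x. g (x + k) = ?\<theta> k * g x" "norm (?\<theta> k) = 1" if k: "k \<in> ?H" for k
  proof -
    obtain l where l: "norm l = 1" "\<And>x. g (x + k) = l * g x" using k by blast
    then have "?\<theta> k = l" using assms by simp
    with l show "\<And>x. g (x + k) = ?\<theta> k * g x" "norm (?\<theta> k) = 1" by simp_all
  qed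
  have uminus: "- k \<in> ?H" if k: "k \<in> ?H" for k
  proof -
    have "g (x + - k) = inverse (?\<theta> k) * g x" for x
      using val(1)[OF k, of "x - k"] val(2)[OF k] by (auto simp: field_simps)
    moreover have "norm (inverse (?\<theta> k)) = 1" unfolding norm_inverse val(2)[OF k] by simp
    ultimately show ?thesis by blast
  qed
  have add: "k + m \<in> ?H \<and> ?\<theta> (k + m) = ?\<theta> k * ?\<theta> m" if k: "k \<in> ?H" and m: "m \<in> ?H" for k m
  proof
    have *: "g (x + (k + m)) = ?\<theta> m * ?\<theta> k * g x" for x
      unfolding add.assoc[symmetric] val(1)[OF m, of "x + k"] val(1)[OF k, of x] by simp
    moreover have "norm (?\<theta> m * ?\<theta> k) = 1" unfolding norm_mult val(2)[OF m] val(2)[OF k] by simp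
    ultimately show "k + m \<in> ?H" by blast
    show "?\<theta> (k + m) = ?\<theta> k * ?\<theta> m" using *[of y] assms by simp
  qed
  have "0 \<in> ?H" by (auto intro!: exI[of _ 1])
  then show ?thesis unfolding char_on_def using uminus val(2) add by blast
qed

subsection \<open>Tiles of prime cardinality\<close>

lemma tiles_indicator:
  assumes "finite A" "tiles A"
  obtains f :: "'a::ab_group_add \<Rightarrow> int"
  where "\<And>x. f x \<in> {0, 1}" "\<And>x. (\<Sum>a\<in>A. f (x - a)) = 1"
proof -
  obtain B where disj: "disjoint_family_on (\<lambda>b. (\<lambda>a. a + b) ` A) B"
    and cover: "(\<Union>b\<in>B. (\<lambda>a. a + b) ` A) = UNIV"
    using assms unfolding tiles_def by blast
  have "(\<Sum>a\<in>A. of_bool (x - a \<in> B)) = (1::int)" for x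
  proof -
    have "x \<in> (\<Union>b\<in>B. (\<lambda>a. a + b) ` A)" unfolding cover by simp
    then obtain a b where ab: "b \<in> B" "a \<in> A" "x = a + b" by blast
    \<comment> \<open>Both \<open>A + b\<close> and \<open>A + (x - c)\<close> contain
      \<open>x\<close>, so disjointness forces \<open>x - c = b\<close>.\<close>
    have uniq: "c = a" if c: "c \<in> A" "x - c \<in> B" for c
    proof -
      have "x \<in> (\<lambda>a. a + b) ` A \<inter> (\<lambda>a. a + (x - c)) ` A"
        using ab c(1) by (auto intro: image_eqI[of _ _ c])
      then have "x - c = b"
        using disj c(2) ab(1) unfolding disjoint_family_on_def by blast
      then show ?thesis using ab(3) by (simp add: algebra_simps)
    qed
    have "(\<Sum>c\<in>A. of_bool (x - c \<in> B)) = (\<Sum>c\<in>A. if c = a then 1 else (0::int))"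
      using uniq ab by (intro sum.cong refl) auto
    then show ?thesis using assms(1) ab(2) by simp
  qed
  then show ?thesis using that[of "\<lambda>x. of_bool (x \<in> B)"] by auto
qed

text \<open>The values of the character at \<open>a - a0\<close> are eigenvalues of a joint
  eigenfunction; their power sums vanish because all dilates annihilate that function.\<close>

lemma prime_tile_character:
  fixes A :: "(int ^ 'd) set"
  assumes p: "prime (card A)" and tile: "tiles A" and a0: "a0 \<in> A"
  obtains \<phi> where "group_character \<phi>" "\<And>a. a \<in> A \<Longrightarrow> \<phi> (a - a0) ^ card A = 1"
    "\<And>t. 0 < t \<Longrightarrow> t < card A \<Longrightarrow> (\<Sum>a\<in>A. \<phi> (a - a0) ^ t) = 0"
proof -
  let ?p = "card A"
  define D where "D = (\<lambda>a. a - a0) ` A"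
  have p0: "?p > 0" using prime_gt_0_nat[OF p] .
  have fin: "finite A" by (rule card_ge_0_finite[OF p0])
  obtain f :: "int ^ 'd \<Rightarrow> int"
    where f01: "\<And>x. f x \<in> {0, 1}" and one: "\<And>x. (\<Sum>a\<in>A. f (x - a)) = 1"
    using tiles_indicator[OF fin tile] by blast
  have "f x \<ge> 0" for x using f01[of x] by auto
  then have dilate: "(\<Sum>a\<in>A. f (x - int t *s a)) = 1" if "0 < t" "t < ?p" for x t
  proof (intro coprime_dilate_sum fin one that(1))
    show "coprime t ?p" using that p by (metis coprime_commute nat_dvd_not_less prime_imp_coprime)
  qed
  \<comment> \<open>Otherwise the \<open>p\<close> terms of the tiling identity at \<open>a0\<close>
    would all equal \<open>f 0\<close>, making \<open>p\<close> a divisor of 1.\<close>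
  have "\<exists>d\<in>D. \<exists>x. f (x + d) \<noteq> f x"
  proof (rule ccontr)
    assume "\<not> ?thesis"
    then have inv: "f (x + (a - a0)) = f x" if "a \<in> A" for a x using that unfolding D_def by blast
    have "f (a0 - a) = f 0" if "a \<in> A" for a using inv[OF that, of "a0 - a"] by simp
    then have "int ?p * f 0 = 1" using one[of a0] by simp
    then show False using prime_gt_1_nat[OF p] by (simp add: zmult_eq_1_iff)
  qed
  then obtain d x0 where d: "d \<in> D" "f (x0 + d) \<noteq> f x0" by blast
  \<comment> \<open>Taking a difference cancels the constant 1, which makes the dilate identities
    homogeneous. The resulting property \<open>Q\<close> then passes to linear combinations of
    translates, in particular to twisted sums.\<close>
  define G where "G x = (of_int (f (x + d) - f x) :: complex)" for x
  define Q where "Q g \<longleftrightarrow> (\<forall>t x. 0 < t \<and> t < ?p \<longrightarrow> (\<Sum>a\<in>A. g (x - int t *s a)) = 0)"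
    for g :: "int ^ 'd \<Rightarrow> complex"
  have "Q G"
    unfolding Q_def
  proof (intro allI impI)
    fix t x assume t: "0 < t \<and> t < ?p"
    have "(\<Sum>a\<in>A. G (x - int t *s a)) =
        of_int ((\<Sum>a\<in>A. f (x + d - int t *s a)) - (\<Sum>a\<in>A. f (x - int t *s a)))"
      unfolding G_def by (simp add: sum_subtractf diff_add_eq)
    then show "(\<Sum>a\<in>A. G (x - int t *s a)) = 0" using t by (simp add: dilate)
  qed
  have Q_twisted: "Q (twisted_sum ?p e z g)" if "Q g" for g e z
    unfolding Q_def
  proof (intro allI impI)
    fix t x assume t: "0 < t \<and> t < ?p"
    have "(\<Sum>a\<in>A. twisted_sum ?p e z g (x - int t *s a)) =
        (\<Sum>n<?p. z ^ n * (\<Sum>a\<in>A. g (x + int n *s e - int t *s a)))"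
      unfolding twisted_sum_def sum_distrib_left diff_add_eq by (rule sum.swap)
    then show "(\<Sum>a\<in>A. twisted_sum ?p e z g (x - int t *s a)) = 0"
      using \<open>Q g\<close> t by (simp add: Q_def)
  qed
  have period: "f (x + int ?p *s e) = f x" if "e \<in> D" for e x
    using that prime_tile_periodic[OF p one f01] a0 unfolding D_def by blast
  have G_period: "G (x + int ?p *s e) = G x" if "e \<in> D" for e x
  proof -
    have "x + int ?p *s e + d = x + d + int ?p *s e" by (simp add: add.commute add.left_commute)
    then show ?thesis unfolding G_def by (simp only: period[OF that])
  qed
  have "G x0 \<noteq> 0" using d(2) by (simp add: G_def)
  have "finite D" using fin by (simp add: D_def)
  obtain g w y where g: "Q g" "g y \<noteq> 0" "\<And>e. e \<in> D \<Longrightarrow> w e ^ ?p = 1"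
    "\<And>e x. e \<in> D \<Longrightarrow> g (x + e) = w e * g x"
    by (rule joint_eigenfunction[where Q = Q,
          OF \<open>finite D\<close> p0 G_period \<open>G x0 \<noteq> 0\<close> \<open>Q G\<close> Q_twisted]) (assumption | rule that)+
  have w1: "norm (w e) = 1" if "e \<in> D" for e
    using power_eq_1_iff[OF g(3)[OF that]] p0 by simp
  define H where "H = {k. \<exists>l. norm l = 1 \<and> (\<forall>x. g (x + k) = l * g x)}"
  have "char_on H (\<lambda>k. g (y + k) / g y)"
    unfolding H_def using g(2) by (rule eigenvalues_char_on)
  then obtain \<phi> where \<phi>: "group_character \<phi>" "\<And>k. k \<in> H \<Longrightarrow> \<phi> k = g (y + k) / g y"
    by (rule char_on_extend) blast
  have \<phi>w: "\<phi> e = w e" if "e \<in> D" for e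
  proof -
    have "e \<in> H" unfolding H_def using w1[OF that] g(4)[OF that] by blast
    then show ?thesis using \<phi>(2) g(2) g(4)[OF that] by simp
  qed
  have "(\<Sum>a\<in>A. \<phi> (a - a0) ^ t) = 0" if t: "0 < t" "t < ?p" for t
  proof -
    have iter: "g (x + int n *s e) = w e ^ n * g x" if "e \<in> D" for e n x
    proof (induction n)
      case (Suc n)
      have "x + int (Suc n) *s e = (x + int n *s e) + e" by simp
      then show ?case by (simp only: g(4)[OF that] Suc power_Suc mult.assoc)
    qed simp
    \<comment> \<open>With base point \<open>y + int t *s a0\<close> the argument is
      \<open>y\<close> moved back \<open>t\<close> times by \<open>a - a0\<close>, so the inverse,
      that is conjugate, eigenvalue power appears.\<close>
    have summand: "g (y + int t *s a0 - int t *s a) = cnj (\<phi> (a - a0) ^ t) * g y" if a: "a \<in> A" for a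
    proof -
      let ?e = "a - a0" and ?x = "y + int t *s a0 - int t *s a"
      have e: "?e \<in> D" using a by (simp add: D_def)
      have "?x + int t *s ?e = y" by simp
      then have "g y = \<phi> ?e ^ t * g ?x" using iter[OF e, of ?x t] \<phi>w[OF e] by simp
      moreover have "cnj (\<phi> ?e ^ t) * \<phi> ?e ^ t = 1"
        using complex_norm_square[of "\<phi> ?e ^ t"] group_character_norm[OF \<phi>(1), of ?e]
        by (simp add: norm_power mult.commute)
      ultimately show ?thesis by (metis mult.assoc mult_1)
    qed
    have "cnj (\<Sum>a\<in>A. \<phi> (a - a0) ^ t) * g y = (\<Sum>a\<in>A. g (y + int t *s a0 - int t *s a))"
      unfolding cnj_sum sum_distrib_right by (intro sum.cong refl) (simp only: summand)
    also have "\<dots> = 0" using g(1) t unfolding Q_def by blast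
    finally show ?thesis using g(2) by (simp del: cnj_sum)
  qed
  moreover have "\<phi> (a - a0) ^ ?p = 1" if "a \<in> A" for a
    using g(3)[of "a - a0"] \<phi>w[of "a - a0"] that by (simp add: D_def)
  ultimately show ?thesis using that \<phi>(1) by blast
qed

text \<open>Double counting shows that \<open>u\<close> is injective: the sum over \<open>c\<close>
  and \<open>t\<close> equals \<open>p\<close> times the number of \<open>c\<close> with
  \<open>u c = u b\<close>, while summing over \<open>c\<close> first leaves only
  \<open>t = 0\<close>, which contributes \<open>p\<close>.\<close>

lemma power_sums_zero_imp_orthogonal:
  fixes u :: "'a \<Rightarrow> complex"
  assumes fin: "finite A" and norm: "\<And>a. a \<in> A \<Longrightarrow> norm (u a) = 1"
    and root: "\<And>a. a \<in> A \<Longrightarrow> u a ^ card A = 1"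
    and sums: "\<And>t. 0 < t \<Longrightarrow> t < card A \<Longrightarrow> (\<Sum>a\<in>A. u a ^ t) = 0"
    and ab: "a \<in> A" "b \<in> A"
  shows "(\<Sum>t<card A. u a ^ t * cnj (u b) ^ t) = (if a = b then of_nat (card A) else 0)"
proof -
  let ?p = "card A"
  have p0: "?p > 0" using fin ab by (auto simp: card_gt_0_iff)
  have cnj1: "u c * cnj (u c) = 1" if "c \<in> A" for c
    using complex_norm_square[of "u c"] norm[OF that] by simp
  have geom: "(\<Sum>t<?p. u c ^ t * cnj (u b) ^ t) = (if u c = u b then of_nat ?p else 0)" if c: "c \<in> A" for c
  proof -
    have "(u c * cnj (u b)) ^ ?p = 1"
      using root[OF c] root[OF ab(2)] by (simp add: power_mult_distrib flip: complex_cnj_power)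
    moreover have "u c * cnj (u b) = 1 \<longleftrightarrow> u c = u b"
    proof
      assume "u c * cnj (u b) = 1"
      then show "u c = u b" using cnj1[OF ab(2)] by (metis mult.assoc mult.commute mult_1)
    qed (simp add: cnj1 ab)
    ultimately show ?thesis
      using root_of_unity_sum[of "u c * cnj (u b)" ?p] by (simp add: power_mult_distrib)
  qed
  have "of_nat ?p * of_nat (card {c \<in> A. u c = u b}) =
      (\<Sum>c\<in>A. \<Sum>t<?p. u c ^ t * cnj (u b) ^ t)"
    using fin by (simp add: geom sum.If_cases Int_def mult.commute)
  also have "\<dots> = (\<Sum>t<?p. (\<Sum>c\<in>A. u c ^ t) * cnj (u b) ^ t)"
    by (subst sum.swap) (simp add: sum_distrib_right)
  also have "\<dots> = (\<Sum>t<?p. if t = 0 then of_nat ?p else 0)"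
    using sums by (intro sum.cong refl) auto
  also have "\<dots> = (of_nat ?p :: complex)" using p0 by simp
  finally have "card {c \<in> A. u c = u b} = 1" using p0 by simp
  then obtain d where "{c \<in> A. u c = u b} = {d}" by (rule card_1_singletonE)
  moreover have "b \<in> {c \<in> A. u c = u b}" "u a = u b \<Longrightarrow> a \<in> {c \<in> A. u c = u b}"
    using ab by simp_all
  ultimately have "u a = u b \<longleftrightarrow> a = b" by auto
  then show ?thesis using geom[OF ab(1)] by simp
qed

theorem theorem1:
  fixes p :: nat and A :: "(int ^ 'd) set"
  assumes "prime p"
    and "card A = p"
    and "tiles A"
  shows "spectral A"
proof -
  have p: "prime (card A)" using assms by simp
  have fin: "finite A" by (rule card_ge_0_finite[OF prime_gt_0_nat[OF p]])
  obtain a0 where a0: "a0 \<in> A" using p by fastforce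
  obtain \<phi> where \<phi>: "group_character \<phi>" "\<And>a. a \<in> A \<Longrightarrow> \<phi> (a - a0) ^ card A = 1"
    "\<And>t. 0 < t \<Longrightarrow> t < card A \<Longrightarrow> (\<Sum>a\<in>A. \<phi> (a - a0) ^ t) = 0"
    using prime_tile_character[OF p assms(3) a0] by blast
  have n1: "norm (\<phi> x) = 1" for x by (rule group_character_norm[OF \<phi>(1)])
  have c1: "\<phi> x * cnj (\<phi> x) = 1" for x using complex_norm_square[of "\<phi> x"] n1 by simp
  have split: "\<phi> a = \<phi> a0 * \<phi> (a - a0)" for a
    using \<phi>(1) unfolding group_character_def by (metis add.commute diff_add_cancel)
  \<comment> \<open>For unimodular values the product is the power with exponent
    \<open>s - t\<close>, so this is a vanishing power sum up to the constant factor
    \<open>\<phi> a0 ^ (s - t)\<close>.\<close>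
  have orth_less: "(\<Sum>a\<in>A. \<phi> a ^ s * cnj (\<phi> a) ^ t) = 0" if "t < s" "s < card A" for s t
  proof -
    have "\<phi> a ^ s * cnj (\<phi> a) ^ t = \<phi> a0 ^ (s - t) * \<phi> (a - a0) ^ (s - t)" for a
    proof -
      have "\<phi> a ^ s = \<phi> a ^ (s - t) * \<phi> a ^ t" using that by (simp flip: power_add)
      then have "\<phi> a ^ s * cnj (\<phi> a) ^ t = \<phi> a ^ (s - t)"
        by (simp add: mult.assoc c1 flip: power_mult_distrib)
      then show ?thesis using split[of a] by (metis power_mult_distrib)
    qed
    then show ?thesis using \<phi>(3)[of "s - t"] that by (simp flip: sum_distrib_left)
  qed
  show ?thesis
  proof (rule spectral_of_power_characters[OF fin \<phi>(1)])
    fix s t assume st: "s < card A" "t < card A" "s \<noteq> t"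
    show "(\<Sum>a\<in>A. \<phi> a ^ s * cnj (\<phi> a) ^ t) = 0"
    proof (cases "t < s")
      case False
      have "(\<Sum>a\<in>A. \<phi> a ^ s * cnj (\<phi> a) ^ t) = cnj (\<Sum>a\<in>A. \<phi> a ^ t * cnj (\<phi> a) ^ s)"
        by (simp add: mult.commute)
      then show ?thesis using orth_less[of s t] False st by simp
    qed (use orth_less st in blast)
  next
    fix a b assume ab: "a \<in> A" "b \<in> A"
    \<comment> \<open>The factor \<open>\<phi> a0\<close> cancels against its conjugate, so the base
      point may be moved to \<open>a0\<close>.\<close>
    have "\<phi> a ^ t * cnj (\<phi> b) ^ t = \<phi> (a - a0) ^ t * cnj (\<phi> (b - a0)) ^ t" for t
    proof -
      have "\<phi> a * cnj (\<phi> b) = (\<phi> a0 * cnj (\<phi> a0)) * (\<phi> (a - a0) * cnj (\<phi> (b - a0)))"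
        using split[of a] split[of b] by (simp add: mult_ac)
      then show ?thesis by (simp add: c1 flip: power_mult_distrib)
    qed
    then show "(\<Sum>t<card A. \<phi> a ^ t * cnj (\<phi> b) ^ t) = (if a = b then of_nat (card A) else 0)"
      using power_sums_zero_imp_orthogonal[of A "\<lambda>a. \<phi> (a - a0)", OF fin n1 \<phi>(2,3) ab] by simp
  qed
qed

end
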